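(* Let $p$ be an odd prime, let $k$ be an integer with $0\le k\le p-1$, and let $n>0$ be an odd integer. Consider $$f_{n,k}(x)=k\sum_{j\geq 0}\binom{n-1}{2j+1}(x^j-x^{j+1})+2\sum_{j\geq 0}\binom{n}{2j}x^j\in\mathbb{F}_p[x].$$ Then $f_{n,k}(x)$ is self-reciprocal if and only if one of the following holds: (i) $n=1$ (for any $k$); (ii) $k=0$ and $n=p^l$ for some positive integer $l$; (iii) $n=3$ and $k=3$, with $p>3$; (iv) $k=1$ and $n+1\neq 2lp$ for every positive integer $l$.
   Context: Binomial coefficients $\binom{a}{b}$ are $0$ when $b>a$; coefficients are reduced modulo $p$. A nonzero polynomial $f(x)$ of (actual) degree $d\ge 0$ is self-reciprocal if $x^d f(1/x)=f(x)$, i.e. writing $f(x)=\sum_{i=0}^d a_ix^i$ with $a_d\neq0$, $a_i=a_{d-i}$ for $0\le i\le d$; nonzero constants count as self-reciprocal. *)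

theory Defs
  imports
    "HOL-Computational_Algebra.Polynomial"
    "Berlekamp_Zassenhaus.Finite_Field"
begin

(* For f of degree d, reflect_poly f is x^d f(1/x): it reverses the coefficients a_0, ..., a_d.
   Since reflect_poly 0 = 0, the zero polynomial has to be excluded explicitly. *)
definition self_reciprocal :: "'a::zero poly \<Rightarrow> bool" where
  "self_reciprocal f \<longleftrightarrow> f \<noteq> 0 \<and> reflect_poly f = f"

lemma self_reciprocal_iff_coeff:
  "self_reciprocal f \<longleftrightarrow>
     f \<noteq> 0 \<and> (\<forall>i\<le>degree f. coeff f i = coeff f (degree f - i))"
proof -
  have "reflect_poly f = f \<longleftrightarrow> (\<forall>i\<le>degree f. coeff f i = coeff f (degree f - i))"
  proof
    assume eq: "reflect_poly f = f"
    show "\<forall>i\<le>degree f. coeff f i = coeff f (degree f - i)"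
    proof (intro allI impI)
      fix i assume "i \<le> degree f"
      have "coeff f i = coeff (reflect_poly f) i"
        by (simp only: eq)
      also have "\<dots> = coeff f (degree f - i)"
        using \<open>i \<le> degree f\<close> by (simp add: coeff_reflect_poly)
      finally show "coeff f i = coeff f (degree f - i)" .
    qed
  next
    assume sym: "\<forall>i\<le>degree f. coeff f i = coeff f (degree f - i)"
    show "reflect_poly f = f"
    proof (rule poly_eqI)
      fix i
      show "coeff (reflect_poly f) i = coeff f i"
      proof (cases "i \<le> degree f")
        case True
        have "coeff (reflect_poly f) i = coeff f (degree f - i)"
          using True by (simp add: coeff_reflect_poly)
        also have "\<dots> = coeff f i"
          by (rule sym[rule_format, OF True, symmetric])
        finally show ?thesis .
      next
        case False
        then show ?thesis
          by (simp add: coeff_reflect_poly coeff_eq_0)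
      qed
    qed
  qed
  then show ?thesis
    by (simp only: self_reciprocal_def)
qed

(* The sums over all j >= 0 are truncated at j = n: for j > n both binomial coefficients vanish.
   The index n - 1 is natural-number subtraction, so f_poly is meant for n > 0.
   The coefficients are natural numbers mapped into F_p by of_nat. *)
definition f_poly :: "nat \<Rightarrow> nat \<Rightarrow> 'p::prime_card mod_ring poly" where
  "f_poly n k =
     of_nat k * (\<Sum>j\<le>n. of_nat ((n - 1) choose (2 * j + 1)) * (monom 1 j - monom 1 (j + 1)))
     + 2 * (\<Sum>j\<le>n. of_nat (n choose (2 * j)) * monom 1 j)"

end

theory Submission
  imports Defs "HOL-Algebra.Exponent"
begin

text \<open>
  Write \<open>G a b = (1 + y)^n (a + b y)\<close>. Then \<open>y f(y^2)\<close> is the odd part of \<open>G k (2 - k)\<close>, and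
  reversing coefficients turns \<open>G a b\<close> into \<open>G b a\<close>. Let \<open>n = 2 m + 1\<close> and \<open>e = m - deg f\<close>. If \<open>f\<close> is
  self-reciprocal, then \<open>y^(2 e) G k (2 - k) - G (2 - k) k = (1 + y)^n h\<close> is an even polynomial, where
  \<open>h = y^(2 e) (k + (2 - k) y) - ((2 - k) + k y)\<close>. Substituting \<open>- y\<close> for \<open>y\<close> shows that
  \<open>(1 - y)^n\<close> divides \<open>(1 + y)^n h\<close>, hence \<open>h\<close>. As \<open>h\<close> has degree at most \<open>2 e + 1 \<le> n\<close>, either \<open>n = 1\<close>,
  or \<open>h = 0\<close>, which forces \<open>k = 1\<close>, or \<open>h\<close> is a scalar multiple of \<open>(y - 1)^n\<close>, so that almost all
  binomial coefficients \<open>n choose i\<close> vanish modulo \<open>p\<close>.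
\<close>

section \<open>Coefficients of \<open>G a b\<close> and their relation to f\<close>

text \<open>This is \<open>G a b\<close> of the overview.\<close>

definition twisted_binomial_poly :: "'a \<Rightarrow> 'a \<Rightarrow> nat \<Rightarrow> 'a::comm_ring_1 poly" where
  "twisted_binomial_poly a b n = [:1, 1:] ^ n * [:a, b:]"

lemma coeff_one_plus_X_power:
  "coeff ([:1, 1:] ^ n :: 'a::comm_ring_1 poly) i = of_nat (n choose i)"
proof (cases "i \<le> n")
  case True
  then show ?thesis by (simp add: coeff_linear_poly_power)
next
  case False
  have "degree ([:1, 1:] ^ n :: 'a poly) \<le> n"
    using degree_power_le[of "[:1, 1:] :: 'a poly" n] by simp
  with False show ?thesis by (simp add: coeff_eq_0 binomial_eq_0)
qed

lemma coeff_twisted_binomial_poly_0 [simp]: "coeff (twisted_binomial_poly a b n) 0 = a"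
  by (simp add: twisted_binomial_poly_def coeff_mult_0 coeff_one_plus_X_power)

lemma coeff_twisted_binomial_poly_Suc:
  "coeff (twisted_binomial_poly a b n) (Suc i) =
     a * of_nat (n choose Suc i) + b * of_nat (n choose i)"
  by (simp add: twisted_binomial_poly_def mult.commute[of "[:1, 1:] ^ n"] coeff_one_plus_X_power)

text \<open>\<open>(1 + y)^n\<close> is palindromic and \<open>a + b y\<close> reverses to
  \<open>b + a y\<close>. Indices are reflected at \<open>Suc n\<close> rather than at the degree,
  which is smaller when \<open>b = 0\<close>.\<close>

lemma coeff_twisted_binomial_poly_swap:
  assumes "i \<le> Suc n"
  shows "coeff (twisted_binomial_poly a b n) (Suc n - i) = coeff (twisted_binomial_poly b a n) i"
proof (cases i)
  case 0
  then show ?thesis by (simp add: coeff_twisted_binomial_poly_Suc binomial_eq_0)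
next
  case (Suc i')
  show ?thesis
  proof (cases "i' = n")
    case True
    with Suc show ?thesis by (simp add: coeff_twisted_binomial_poly_Suc binomial_eq_0)
  next
    case False
    with Suc assms have lt: "i' < n" by simp
    then have "Suc n - i = Suc (n - i)" "n choose Suc (n - i) = n choose i'"
      "n choose (n - i) = n choose i"
      using Suc binomial_symmetric[of i' n] binomial_symmetric[of i n] by (auto simp: Suc_diff_Suc)
    with Suc show ?thesis
      by (simp only: coeff_twisted_binomial_poly_Suc) (simp add: add.commute)
  qed
qed

lemma coeff_of_nat_mult: "coeff (of_nat k * q) i = of_nat k * coeff q i"
  by (simp add: of_nat_poly)

text \<open>Adding and subtracting \<open>(n - 1) choose (2 * j)\<close>, Pascal's rule turns the
  bracket after k into \<open>(n choose (2 * j + 1)) - (n choose (2 * j))\<close>.\<close>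

lemma coeff_f_poly:
  fixes n k j :: nat
  assumes "n > 0"
  shows "coeff (f_poly n k :: 'p::prime_card mod_ring poly) j =
    coeff (twisted_binomial_poly (of_nat k) (2 - of_nat k) n) (Suc (2 * j))"
proof -
  obtain n' where n': "n = Suc n'" using assms by (cases n) auto
  have *: "(\<Sum>i\<le>n. of_nat (h i) * (if i = c then 1 else 0 :: 'p mod_ring)) =
      (if c \<le> n then of_nat (h c) else 0)" for h :: "nat \<Rightarrow> nat" and c
    by (simp add: if_distrib cong: if_cong)
  have **: "(\<Sum>i\<le>n. of_nat (h i) * (if Suc i = c then 1 else 0 :: 'p mod_ring)) =
      (case c of 0 \<Rightarrow> 0 | Suc c' \<Rightarrow> if c' \<le> n then of_nat (h c') else 0)" for h :: "nat \<Rightarrow> nat" and c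
    by (cases c) (simp_all add: if_distrib cong: if_cong)
  have two: "coeff (2 * q :: 'p mod_ring poly) i = 2 * coeff q i" for q i
    using coeff_of_nat_mult[of 2] by simp
  \<comment> \<open>The bounds left over from the truncated sums disappear because the binomial
    coefficients vanish beyond them; for \<open>j = 0\<close> the term \<open>x^(j+1)\<close>
    contributes nothing.\<close>
  have "coeff (f_poly n k :: 'p mod_ring poly) j =
      of_nat k * (of_nat ((n - 1) choose Suc (2 * j)) -
        (case j of 0 \<Rightarrow> 0 | Suc i \<Rightarrow> of_nat ((n - 1) choose Suc (2 * i)))) +
      2 * of_nat (n choose (2 * j))"
    unfolding f_poly_def
    by (auto simp: coeff_sum coeff_of_nat_mult two right_diff_distrib sum_subtractf * **
        binomial_eq_0 split: nat.split)
  also have "\<dots> = coeff (twisted_binomial_poly (of_nat k) (2 - of_nat k) n) (Suc (2 * j))"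
    unfolding coeff_twisted_binomial_poly_Suc n'
    by (cases j) (simp_all add: algebra_simps)
  finally show ?thesis .
qed

section \<open>Even polynomials and divisibility by powers of \<open>y - 1\<close>\<close>

lemma pcompose_uminus_X_of_even:
  fixes q :: "'a::comm_ring_1 poly"
  assumes "\<And>i. odd i \<Longrightarrow> coeff q i = 0"
  shows "pcompose q [:0, - 1:] = q"
proof (rule poly_eqI)
  fix i show "coeff (pcompose q [:0, - 1:]) i = coeff q i"
    using assms[of i] by (cases "even i") (simp_all add: coeff_pcompose_linear)
qed

text \<open>As \<open>2 \<noteq> 0\<close>, 1 is not a root of \<open>1 + y\<close>, so the whole
  order of the product at 1 comes from h.\<close>

lemma X_minus_one_power_dvd_cancel:
  fixes h :: "'a::idom poly"
  assumes two: "(2 :: 'a) \<noteq> 0" and dvd: "[:- 1, 1:] ^ n dvd [:1, 1:] ^ n * h"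
  shows "[:- 1, 1:] ^ n dvd h"
proof (cases "h = 0")
  case False
  have "order 1 ([:1, 1 :: 'a:] ^ n) = 0"
    using two by (intro order_0I) simp
  with False dvd show ?thesis
    by (simp add: order_divides order_mult)
qed simp

text \<open>Reciprocity reflects the coefficients of f at \<open>degree f\<close>, while swapping a
  and b reflects them at m. The shift by \<open>2 * (m - degree f)\<close> bridges this gap and
  makes the odd coefficients of q cancel.\<close>

lemma X_minus_one_power_dvd_of_self_reciprocal:
  fixes f :: "'a::idom poly"
  assumes two: "(2 :: 'a) \<noteq> 0" and n: "n = 2 * m + 1"
    and f: "\<And>j. coeff f j = coeff (twisted_binomial_poly a b n) (Suc (2 * j))"
    and rec: "reflect_poly f = f" and deg: "degree f \<le> m"
  shows "[:- 1, 1:] ^ n dvd monom 1 (2 * (m - degree f)) * [:a, b:] - [:b, a:]"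
proof -
  define e where "e = m - degree f"
  define h where "h = monom 1 (2 * e) * [:a, b:] - [:b, a:]"
  define q where "q = [:1, 1:] ^ n * h"
  have q: "q = monom 1 (2 * e) * twisted_binomial_poly a b n - twisted_binomial_poly b a n"
    by (simp add: q_def h_def twisted_binomial_poly_def algebra_simps)
  have "coeff q i = 0" if "odd i" for i
  proof -
    from that obtain j where j: "i = Suc (2 * j)" by (auto elim: oddE)
    have 1: "coeff (monom 1 (2 * e) * twisted_binomial_poly a b n) i =
        (if j < e then 0 else coeff f (j - e))"
      by (auto simp: coeff_monom_mult j f Suc_diff_le right_diff_distrib')
    have 2: "coeff (twisted_binomial_poly b a n) i = (if j \<le> m then coeff f (m - j) else 0)"
    proof (cases "j \<le> m")
      case True
      then have "Suc n - i = Suc (2 * (m - j))" using n j by simp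
      with True show ?thesis
        using coeff_twisted_binomial_poly_swap[of i n a b] n j f[of "m - j"] by simp
    next
      case False
      then show ?thesis by (simp add: coeff_twisted_binomial_poly_Suc j n binomial_eq_0)
    qed
    \<comment> \<open>For \<open>j < e\<close> the index \<open>m - j\<close> exceeds
      \<open>degree f\<close>, and for \<open>j > m\<close> the index \<open>j - e\<close> does; in
      both ranges both terms are 0.\<close>
    have "coeff f (m - j) = (if m - j \<le> degree f then coeff f (degree f - (m - j)) else 0)"
      using coeff_reflect_poly[of f "m - j"] rec by simp
    moreover have "degree f - (m - j) = j - e" if "e \<le> j" "j \<le> m"
      using that deg by (simp add: e_def)
    moreover have "coeff f (j - e) = 0" if "j > m"
      using that deg by (intro coeff_eq_0) (simp add: e_def)
    ultimately show ?thesis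
      unfolding q coeff_diff 1 2 using deg by (auto simp: e_def)
  qed
  then have "q = pcompose q [:0, - 1:]" by (rule pcompose_uminus_X_of_even[symmetric])
  also have "\<dots> = [:1, - 1:] ^ n * pcompose h [:0, - 1:]"
    by (simp add: q_def pcompose_mult pcompose_hom.hom_power pcompose_pCons)
  also have "[:1, - 1 :: 'a:] ^ n = - ([:- 1, 1:] ^ n)"
    using n power_minus_odd[of n "[:- 1, 1 :: 'a:]"] by simp
  finally have "[:- 1, 1:] ^ n dvd [:1, 1:] ^ n * h" by (simp add: q_def)
  with two have "[:- 1, 1:] ^ n dvd h" by (rule X_minus_one_power_dvd_cancel)
  then show ?thesis by (simp add: h_def e_def)
qed

section \<open>Binomial coefficients divisible by a prime\<close>

text \<open>By absorption \<open>p^l\<close> divides \<open>i * (p^l choose i)\<close>; if p did not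
  divide the second factor, \<open>p^l\<close> would divide the smaller number i.\<close>

lemma binomial_prime_power_dvd:
  fixes p :: nat
  assumes "prime p" "0 < i" "i < p ^ l"
  shows "p dvd (p ^ l choose i)"
proof (rule ccontr)
  assume "\<not> ?thesis"
  then have "coprime (p ^ l) (p ^ l choose i)"
    using assms by (simp add: prime_imp_coprime)
  moreover have "p ^ l dvd i * (p ^ l choose i)"
    using binomial_absorption[of "i - 1" "p ^ l"] assms by simp
  ultimately have "p ^ l dvd i" by (simp add: coprime_dvd_mult_left_iff)
  then show False using assms by (auto dest: dvd_imp_le)
qed

text \<open>If \<open>n = p^l * r\<close> with r prime to p, then \<open>n choose p^l\<close> has
  the same p-multiplicity as r, namely 0. So \<open>p^l\<close> cannot lie strictly below n.\<close>

lemma prime_power_of_dvd_binomial: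
  fixes p :: nat
  assumes "prime p" "n > 1" and dvd: "\<And>i. 0 < i \<Longrightarrow> i < n \<Longrightarrow> p dvd (n choose i)"
  shows "\<exists>l>0. n = p ^ l"
proof -
  obtain r where r: "n = p ^ multiplicity p n * r" "\<not> p dvd r"
    using multiplicity_decompose'[of n p] assms not_prime_unit by (metis not_one_less_zero)
  define l where "l = multiplicity p n"
  have "r > 0" using r assms by (intro gr0I) auto
  have "multiplicity p (n choose p ^ l) = multiplicity p r"
    using const_p_fac[OF \<open>r > 0\<close> assms(1), of l] r by (simp add: l_def)
  also have "\<dots> = 0" using r(2) by (rule not_dvd_imp_multiplicity_0)
  finally have "multiplicity p (n choose p ^ l) = 0" .
  moreover have "p ^ l \<le> n" using r \<open>r > 0\<close> by (metis l_def dvd_imp_le dvd_triv_left assms(2) less_trans zero_less_one)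
  \<comment> \<open>Multiplicity 0 excludes divisibility only for a nonzero number;
    \<open>p ^ l \<le> n\<close> makes the binomial coefficient nonzero.\<close>
  ultimately have "\<not> p dvd (n choose p ^ l)"
    using assms(1) multiplicity_eq_zero_iff[of "n choose p ^ l" p]
    by (metis binomial_eq_0_iff not_less not_prime_unit)
  then have "\<not> p ^ l < n"
    using dvd[of "p ^ l"] assms(1) by (auto simp: prime_gt_0_nat)
  then have "n = p ^ l" using \<open>p ^ l \<le> n\<close> by simp
  moreover have "l > 0" using \<open>n = p ^ l\<close> assms(2) by (intro gr0I) auto
  ultimately show ?thesis by blast
qed

section \<open>The degree argument for h\<close>

lemma X_minus_one_power_dvd_binomials:
  fixes a b :: "'a::idom"
  defines "h \<equiv> (\<lambda>e. monom 1 (2 * e) * [:a, b:] - [:b, a:])"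
  assumes ab: "a \<noteq> 0 \<or> b \<noteq> 0" and n: "n \<ge> 2" and e: "2 * e + 1 \<le> n"
    and dvd: "[:- 1, 1:] ^ n dvd h e"
  shows "e = 0 \<and> a = b \<or>
    n = 2 * e + 1 \<and> b \<noteq> 0 \<and> h e = smult b ([:- 1, 1:] ^ n)"
proof -
  have coeff_h: "coeff (h e) i = (if i = 2 * e then a else 0) + (if i = 2 * e + 1 then b else 0)
      - (if i = 0 then b else 0) - (if i = 1 then a else 0)" for i
    by (auto simp: h_def coeff_monom_mult coeff_pCons split: nat.splits)
  have deg: "degree ([:- 1, 1 :: 'a:] ^ n) = n"
    by (simp add: degree_power_eq)
  show ?thesis
  proof (cases "h e = 0")
    case True
    \<comment> \<open>For \<open>e > 0\<close> these two coefficients are \<open>- b\<close> and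
      \<open>- a\<close>, which are not both 0; for \<open>e = 0\<close> they give
      \<open>a = b\<close>.\<close>
    then have "coeff (h e) 0 = 0" "coeff (h e) 1 = 0" by simp_all
    then show ?thesis
      using ab unfolding coeff_h by (auto split: if_splits)
  next
    case False
    obtain c where c: "h e = [:- 1, 1:] ^ n * c" using dvd by (elim dvdE)
    have "degree (h e) \<le> 2 * e + 1"
      by (rule degree_le) (auto simp: coeff_h)
    moreover have deg_h: "degree (h e) = n + degree c"
      using False deg by (simp add: c degree_mult_eq)
    ultimately have ne: "n = 2 * e + 1" and "degree c = 0" using e by simp_all
    then obtain c0 where c0: "c = [:c0:]" by (auto elim: degree_eq_zeroE)
    \<comment> \<open>Since \<open>n \<ge> 2\<close>, the term \<open>- a\<close> at index 1 does
      not interfere.\<close>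
    have lead: "coeff (h e) n = b" using n ne by (simp add: coeff_h)
    have "coeff ([:- 1, 1 :: 'a:] ^ n) n = 1"
      using deg by (simp add: coeff_linear_poly_power)
    then have "c0 = b" using lead by (simp add: c c0)
    moreover have "b \<noteq> 0" using lead deg_h c0 False by (metis add_0_right \<open>degree c = 0\<close> leading_coeff_0_iff)
    ultimately show ?thesis using ne by (simp add: c c0)
  qed
qed

section \<open>The classification over the field with p elements\<close>

lemma of_nat_mod_ring_eq_0_iff:
  "(of_nat x :: 'p::prime_card mod_ring) = 0 \<longleftrightarrow> CARD('p) dvd x"
  by (simp add: of_nat_eq_0_iff_char_dvd)

lemma self_reciprocal_const: "c \<noteq> 0 \<Longrightarrow> self_reciprocal [:c:]"
  by (simp add: self_reciprocal_def)

theorem theorem3p4: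
  fixes p n k :: nat
  assumes p: "p = CARD('p::prime_card)" "odd p"
    and k: "k \<le> p - 1"
    and n: "n > 0" "odd n"
  shows "self_reciprocal (f_poly n k :: 'p mod_ring poly) \<longleftrightarrow>
      n = 1
    \<or> (k = 0 \<and> (\<exists>l::nat. l > 0 \<and> n = p ^ l))
    \<or> (n = 3 \<and> k = 3 \<and> p > 3)
    \<or> (k = 1 \<and> (\<forall>l::nat. l > 0 \<longrightarrow> n + 1 \<noteq> 2 * l * p))"
proof -
  have prime: "prime p" using p(1) prime_card by simp
  have p3: "p \<ge> 3" using prime p(2) prime_ge_2_nat[of p] by (cases "p = 2") auto
  have zero_iff: "(of_nat x :: 'p mod_ring) = 0 \<longleftrightarrow> p dvd x" for x
    using p(1) by (simp add: of_nat_mod_ring_eq_0_iff)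
  have two: "(2 :: 'p mod_ring) \<noteq> 0"
    using zero_iff[of 2] p3 by (auto dest: dvd_imp_le)
  have k_zero: "(of_nat k :: 'p mod_ring) = 0 \<longleftrightarrow> k = 0"
    using k p3 by (auto simp: zero_iff dest!: dvd_imp_le)
  have k_eq: "(of_nat k :: 'p mod_ring) = of_nat j \<Longrightarrow> k = j" if "j < p" for j
    using that k p3 by (simp add: of_nat_eq_iff_cong_CHAR cong_def flip: p(1))
  define f :: "'p mod_ring poly" where "f = f_poly n k"
  define a b :: "'p mod_ring" where "a = of_nat k" and "b = 2 - of_nat k"
  have ab: "a + b = 2" by (simp add: a_def b_def)
  have cf: "coeff f j = coeff (twisted_binomial_poly a b n) (Suc (2 * j))" for j
    using coeff_f_poly[OF n(1)] by (simp add: f_def a_def b_def)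
  note cf' = cf[unfolded coeff_twisted_binomial_poly_Suc]
  obtain m where m: "n = 2 * m + 1" using n(2) by (auto elim: oddE)
  have deg: "degree f \<le> m"
    by (rule degree_le) (auto simp: cf' m binomial_eq_0)
  \<comment> \<open>\<open>n + 1\<close> is even and p odd, so the cofactor of p is even: condition
    (iv) excludes exactly \<open>p dvd n + 1\<close>.\<close>
  have dvd_Suc_n: "p dvd n + 1 \<longleftrightarrow> (\<exists>l>0. n + 1 = 2 * l * p)"
  proof
    assume "p dvd n + 1"
    then obtain c where c: "n + 1 = p * c" by (elim dvdE)
    have "even (p * c)" using n(2) c by (metis even_plus_one_iff)
    then obtain l where "c = 2 * l" using p(2) by (auto elim: evenE)
    then show "\<exists>l>0. n + 1 = 2 * l * p" using c by (intro exI[of _ l]) (auto intro: gr0I)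
  qed auto
  \<comment> \<open>In cases (i) to (iii) f is a nonzero constant.\<close>
  have const: "self_reciprocal f" if "\<And>j. j > 0 \<Longrightarrow> coeff f j = 0" "coeff f 0 \<noteq> 0"
  proof -
    have "f = [:coeff f 0:]"
      using that by (intro poly_eqI) (auto simp: coeff_pCons split: nat.split)
    then show ?thesis using self_reciprocal_const[OF that(2)] by simp
  qed
  have "self_reciprocal f \<longleftrightarrow> n = 1 \<or> (k = 0 \<and> (\<exists>l>0. n = p ^ l)) \<or>
      (n = 3 \<and> k = 3 \<and> p > 3) \<or> (k = 1 \<and> \<not> p dvd n + 1)" (is "_ \<longleftrightarrow> ?rhs")
  proof
    assume sr: "self_reciprocal f"
    then have rec: "reflect_poly f = f" and "f \<noteq> 0" by (simp_all add: self_reciprocal_def)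
    define e where "e = m - degree f"
    define h where "h = monom 1 (2 * e) * [:a, b:] - [:b, a:]"
    have "[:- 1, 1:] ^ n dvd h"
      unfolding h_def e_def
      using X_minus_one_power_dvd_of_self_reciprocal[OF two m cf rec deg] .
    moreover have "a \<noteq> 0 \<or> b \<noteq> 0" using ab two by auto
    moreover have "2 * e + 1 \<le> n" by (simp add: e_def m)
    ultimately consider "n = 1" | "n \<ge> 3" "a = b" |
      "n \<ge> 3" "n = 2 * e + 1" "b \<noteq> 0" "h = smult b ([:- 1, 1:] ^ n)"
      using X_minus_one_power_dvd_binomials[of a b n e] m unfolding h_def by fastforce
    then show ?rhs
    proof cases
      case 2
      then have "2 * (of_nat k - 1) = (0 :: 'p mod_ring)" by (simp add: a_def b_def algebra_simps)
      then have "(of_nat k :: 'p mod_ring) = of_nat 1" using two by simp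
      then have "k = 1" using k_eq[of 1] p3 by simp
      \<comment> \<open>By reciprocity the constant coefficient equals the leading one; for
        \<open>k = 1\<close> it is \<open>n + 1\<close>.\<close>
      moreover have "coeff f 0 \<noteq> 0"
        using rec \<open>f \<noteq> 0\<close> by (metis coeff_0_reflect_poly leading_coeff_0_iff)
      then have "\<not> p dvd n + 1"
        using zero_iff[of "n + 1"] \<open>k = 1\<close> by (simp add: cf' a_def b_def add.commute)
      ultimately show ?thesis by blast
    next
      case 3
      \<comment> \<open>The coefficients of h are computed twice, from the power of
        \<open>y - 1\<close> and from its definition, and then compared.\<close>
      have coeff_h: "coeff h i = b * of_nat (n choose i) * (- 1) ^ (n - i)" if "i \<le> n" for i
        using that by (simp add: 3(4) coeff_linear_poly_power)
      have coeff_h': "coeff h i = (if i = n - 1 then a else 0) - (if i = 1 then a else 0)"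
        if "0 < i" "i < n" for i
        using that 3(2) by (auto simp: h_def coeff_monom_mult coeff_pCons split: nat.splits)
      have lin: "- a = b * of_nat n"
        using coeff_h[of 1] coeff_h'[of 1] 3(1) n(2) by simp
      show ?thesis
      proof (cases "k = 0")
        case True
        have "p dvd (n choose i)" if "0 < i" "i < n" for i
        proof -
          have "b * of_nat (n choose i) * (- 1) ^ (n - i) = 0"
            using coeff_h[of i] coeff_h'[of i] that True by (simp add: a_def split: if_splits)
          then show ?thesis using \<open>b \<noteq> 0\<close> zero_iff by simp
        qed
        then show ?thesis
          using prime_power_of_dvd_binomial[OF prime, of n] 3(1) True by auto
      next
        case False
        then have "a \<noteq> 0" using k_zero by (simp add: a_def)
        have "n = 3" \<comment> \<open>otherwise the coefficient of \<open>h\<close> at 2 vanishes, so \<open>n\<close> is 0 or 1 modulo \<open>p\<close>\<close>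
        proof (rule ccontr)
          assume "n \<noteq> 3"
          \<comment> \<open>This puts index 2 strictly between 1 and \<open>n - 1\<close>.\<close>
          then have "n \<ge> 5" using 3(1) m by presburger
          then have "b * of_nat (n choose 2) * (- 1) ^ (n - 2) = 0"
            using coeff_h[of 2] coeff_h'[of 2] by (simp split: if_splits)
          then have "p dvd (n choose 2)" using \<open>b \<noteq> 0\<close> zero_iff by simp
          then have "p dvd n * (n - 1)"
            using binomial_absorption[of 1 n] by (metis Suc_1 choose_one dvd_mult One_nat_def)
          then consider "p dvd n" | "p dvd n - 1" using prime prime_dvd_mult_iff by blast
          then show False
          \<comment> \<open>Modulo p, \<open>n = 0\<close> turns \<open>lin\<close> into
            \<open>a = 0\<close>, and \<open>n = 1\<close> turns it into \<open>a + b = 0\<close>,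
            against \<open>a + b = 2\<close>.\<close>
          proof cases
            case 1
            then have "(of_nat n :: 'p mod_ring) = 0" using zero_iff by blast
            then show False using lin \<open>a \<noteq> 0\<close> by simp
          next
            case 2
            then have "(of_nat n :: 'p mod_ring) = 1"
              using zero_iff[of "n - 1"] n(1) by (simp add: of_nat_diff)
            then show False using lin ab two by (metis add.right_inverse mult.right_neutral)
          qed
        qed
        have "2 * (of_nat k - 3) = (0 :: 'p mod_ring)"
          using lin \<open>n = 3\<close> by (simp add: a_def b_def algebra_simps)
        then have "(of_nat k :: 'p mod_ring) - 3 = 0" using two by (simp only: mult_eq_0_iff simp_thms)
        then have k3: "(of_nat k :: 'p mod_ring) = of_nat 3" by simp
        \<comment> \<open>For \<open>p = 3\<close> the equation would make k zero modulo p.\<close>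
        then have "p \<noteq> 3" using k_zero False zero_iff[of 3] by auto
        then have "p > 3" using p3 by simp
        then show ?thesis using k_eq[OF _ k3] \<open>n = 3\<close> by simp
      qed
    qed simp
  next
    assume ?rhs
    then consider "n = 1" | l where "k = 0" "n = p ^ l" |
      "n = 3" "k = 3" "p > 3" | "k = 1" "\<not> p dvd n + 1" by blast
    then show "self_reciprocal f"
    proof cases
      case 1
      show ?thesis using two ab 1 by (intro const) (auto simp: cf' binomial_eq_0)
    next
      case 2
      have "p dvd (n choose (2 * j))" if "j > 0" for j
      proof (cases "2 * j < n")
        case True
        then show ?thesis using binomial_prime_power_dvd[OF prime] that 2(2) by simp
      next
        case False
        \<comment> \<open>\<open>2 * j = n\<close> is impossible because n is odd.\<close>
        then show ?thesis using n(2) by (cases "2 * j = n") (auto simp: binomial_eq_0)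
      qed
      then show ?thesis
        using two 2(1) by (intro const) (auto simp: cf' a_def b_def zero_iff)
    next
      case 3
      \<comment> \<open>The constant coefficient is \<open>3 * 3 - 1 = 8\<close>, the linear one
        \<open>3 * 1 - 1 * 3 = 0\<close>.\<close>
      have "(8 :: 'p mod_ring) \<noteq> 0" using power_not_zero[OF two, of 3] by simp
      moreover have "coeff f j = 0" if "j > 0" for j
        using that 3 by (cases "j = 1") (auto simp: cf' a_def b_def binomial_eq_0 numeral_eq_Suc)
      ultimately show ?thesis
        using 3 by (intro const) (auto simp: cf' a_def b_def)
    next
      case 4
      have n1: "(of_nat (n + 1) :: 'p mod_ring) \<noteq> 0" using 4(2) zero_iff by blast
      \<comment> \<open>Here \<open>a = b = 1\<close>, so the swap is a symmetry of f about m. It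
        amounts to reciprocity once \<open>degree f = m\<close>, which holds as the constant
        coefficient \<open>n + 1\<close> is nonzero.\<close>
      have sym: "coeff f (m - j) = coeff f j" if "j \<le> m" for j
      proof -
        have "Suc n - Suc (2 * j) = Suc (2 * (m - j))" using that m by simp
        then show ?thesis
          using coeff_twisted_binomial_poly_swap[of "Suc (2 * j)" n a b] that m 4(1)
          by (simp add: cf a_def b_def)
      qed
      have "coeff f 0 = of_nat (n + 1)" using 4(1) by (simp add: cf' a_def b_def)
      then have "coeff f m \<noteq> 0" using sym[of 0] n1 by simp
      then have "degree f = m" using deg by (intro antisym le_degree)
      moreover have "f \<noteq> 0" using \<open>coeff f m \<noteq> 0\<close> by auto
      ultimately show ?thesis
        unfolding self_reciprocal_iff_coeff using sym by metis
    qed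
  qed
  moreover have "\<not> p dvd n + 1 \<longleftrightarrow> (\<forall>l::nat. l > 0 \<longrightarrow> n + 1 \<noteq> 2 * l * p)"
    using dvd_Suc_n by blast
  ultimately show ?thesis unfolding f_def by (simp only:)
qed

end
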